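(* Let $x\in\mathbb{R}^d$, let $\mathcal{G}=\{G_r\}_{r=1}^{B}$ with $G_r\subset\{1,\dots,d\}$ and $\bigcup_{r=1}^{B}G_r=\{1,\dots,d\}$, let $\tau>0$, and let $$\hat{\mathcal{G}}:=\{G\in\mathcal{G}:\ \|x\|_{G,2}>\tau\}=:\{\hat G_1,\dots,\hat G_{\hat B}\}.$$ Then the projection of $x$ onto the convex set $\tau K_2^{\mathcal{G}}$, where $K_2^{\mathcal{G}}=\{v\in\mathbb{R}^d:\ \|v\|_{G_r,2}\le 1\ \text{ for } r=1,\dots,B\}$, is given by $$\left[\pi_{\tau K_2^{\mathcal{G}}}(x)\right]_j=\frac{x_j}{1+\sum_{r=1}^{\hat B}\lambda^*_r\mathbf{1}_{r,j}}\qquad\text{for } j=1,\dots,d,$$ where $\lambda^*$ is a solution (any maximizer) of $$\mathop{\mathrm{argmax}}_{\lambda\in\mathbb{R}_+^{\hat B}} f(\lambda),\qquad f(\lambda)=\sum_{j=1}^{d}\frac{-x_j^2}{1+\sum_{r=1}^{\hat B}\mathbf{1}_{r,j}\lambda_r}-\sum_{r=1}^{\hat B}\lambda_r\tau^2,$$ and $\mathbf{1}_{r,j}$ equals $1$ if $j$ belongs to the group $\hat G_r$ and $0$ otherwise.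
   Context: For $G\subset\{1,\dots,d\}$ and $v\in\mathbb{R}^d$, $\|v\|_{G,2}=(\sum_{j\in G}v_j^2)^{1/2}$ is the Euclidean norm of the restriction of $v$ to the coordinates in $G$. $\mathbb{R}_+^{\hat B}$ is the set of vectors in $\mathbb{R}^{\hat B}$ with nonnegative entries. $\pi_C$ denotes the Euclidean projection onto a nonempty closed convex set $C$; note $\tau K_2^{\mathcal{G}}=\{v:\|v\|_{G_r,2}\le\tau,\ r=1,\dots,B\}$. *)

theory Defs
  imports "HOL-Analysis.Analysis"
begin

definition group_norm :: "'d set \<Rightarrow> real ^ 'd \<Rightarrow> real" where
  "group_norm A v = L2_set (\<lambda>j. v $ j) A"

definition K2 :: "nat \<Rightarrow> (nat \<Rightarrow> 'd set) \<Rightarrow> (real ^ 'd) set" where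
  "K2 B G = {v. \<forall>r\<in>{1..B}. group_norm (G r) v \<le> 1}"

definition active_groups :: "nat \<Rightarrow> (nat \<Rightarrow> 'd set) \<Rightarrow> real \<Rightarrow> real ^ 'd \<Rightarrow> 'd set set" where
  "active_groups B G \<tau> x = {A \<in> G ` {1..B}. group_norm A x > \<tau>}"

text \<open>The dimension \<open>n\<close> is a number depending on the data, so a vector of the nonnegative
  orthant is a nonnegative function on \<open>{1..n}\<close>, with the library's default value outside.\<close>

definition nonneg_orthant :: "nat \<Rightarrow> (nat \<Rightarrow> real) set" where
  "nonneg_orthant n = {1..n} \<rightarrow>\<^sub>E {0..}"

definition dual_objective ::
    "nat \<Rightarrow> (nat \<Rightarrow> 'd set) \<Rightarrow> real \<Rightarrow> real ^ 'd \<Rightarrow> (nat \<Rightarrow> real) \<Rightarrow> real" where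
  "dual_objective n H \<tau> x l =
     (\<Sum>j\<in>UNIV. - (x $ j)\<^sup>2 / (1 + (\<Sum>r\<in>{1..n}. indicat_real (H r) j * l r)))
       - (\<Sum>r\<in>{1..n}. l r * \<tau>\<^sup>2)"

end

theory Submission
  imports Defs
begin

text \<open>The function \<open>dual_objective\<close> is, up to the additive constant \<open>(norm x)\<^sup>2\<close>, the Lagrange dual of minimising
  \<open>norm (x - v)\<^sup>2\<close> under the constraints \<open>group_norm A v \<le> \<tau>\<close> for the active groups \<open>A\<close>.
  For multipliers \<open>l\<close> the Lagrangian is minimised coordinatewise by
  \<open>v\<^sub>j = x\<^sub>j / (1 + s\<^sub>j)\<close>, where \<open>s\<^sub>j\<close> adds up the multipliers of the active groups that
  contain \<open>j\<close> (\<open>multiplier_load\<close>, \<open>shrink\<close>).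

  The partial derivative of the dual objective in \<open>l\<^sub>r\<close> is exactly the constraint residual
  \<open>(group_norm (H r) v)\<^sup>2 - \<tau>\<^sup>2\<close>.  Moving a single coordinate of a maximiser therefore yields
  the Karush-Kuhn-Tucker conditions (\<open>dual_maximizer_KKT\<close>): the residual is nonpositive, and it
  vanishes where \<open>l\<^sub>r > 0\<close>.  The first condition makes \<open>v\<close> satisfy the active constraints; an
  inactive group causes no trouble because \<open>x\<close> already satisfies its constraint and \<open>v\<close> is
  coordinatewise no larger than \<open>x\<close>.

  Optimality of \<open>v\<close> is the obtuse-angle criterion (\<open>closest_point_eqI_obtuse\<close>).  As
  \<open>x\<^sub>j - v\<^sub>j = s\<^sub>j * v\<^sub>j\<close>, the inner product of \<open>x - v\<close> and \<open>y - v\<close> splits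
  into a sum over the groups of \<open>l\<^sub>r * (\<langle>v, y\<rangle> - \<langle>v, v\<rangle>)\<close>, both products restricted to the
  group \<open>H r\<close>.  Where \<open>l\<^sub>r > 0\<close>, complementary slackness turns the second product into
  \<open>\<tau>\<^sup>2\<close>, and Cauchy-Schwarz bounds the first one by \<open>\<tau>\<^sup>2\<close>.

  A maximiser exists because the objective is at most \<open>- \<tau>\<^sup>2 * (\<Sum>r. l\<^sub>r)\<close>: outside a large box it
  falls below its value at \<open>0\<close>, and the box is compact.\<close>

section \<open>Projections and group norms\<close>

lemma closest_point_eqI_obtuse:
  fixes v x :: "'a::euclidean_space"
  assumes "v \<in> S" and obtuse: "\<And>y. y \<in> S \<Longrightarrow> (x - v) \<bullet> (y - v) \<le> 0"
  shows "closest_point S x = v"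
proof -
  have pyth: "(dist x v)\<^sup>2 + (dist v y)\<^sup>2 \<le> (dist x y)\<^sup>2" if "y \<in> S" for y
  proof -
    have "(dist x y)\<^sup>2 = (dist x v)\<^sup>2 + (dist v y)\<^sup>2 - 2 * ((x - v) \<bullet> (y - v))"
      unfolding dist_norm power2_norm_eq_inner
      by (simp add: inner_diff_left inner_diff_right inner_commute)
    with obtuse[OF that] show ?thesis by simp
  qed
  show ?thesis
    unfolding closest_point_def
  proof (rule some_equality)
    have "dist x v \<le> dist x y" if "y \<in> S" for y
    proof (rule power2_le_imp_le)
      show "(dist x v)\<^sup>2 \<le> (dist x y)\<^sup>2"
        using pyth[OF that] zero_le_power2[of "dist v y"] by linarith
    qed simp
    with \<open>v \<in> S\<close> show "v \<in> S \<and> (\<forall>y\<in>S. dist x v \<le> dist x y)" by blast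
  next
    fix w assume w: "w \<in> S \<and> (\<forall>y\<in>S. dist x w \<le> dist x y)"
    then have "(dist x w)\<^sup>2 \<le> (dist x v)\<^sup>2"
      using \<open>v \<in> S\<close> by (intro power_mono) auto
    moreover have "(dist x v)\<^sup>2 + (dist v w)\<^sup>2 \<le> (dist x w)\<^sup>2"
      using pyth w by blast
    ultimately have "(dist v w)\<^sup>2 \<le> 0" by linarith
    then show "w = v" by simp
  qed
qed

lemma group_norm_nonneg: "0 \<le> group_norm A v"
  by (simp add: group_norm_def L2_set_nonneg)

lemma group_norm_sq: "(group_norm A v)\<^sup>2 = (\<Sum>j\<in>A. (v $ j)\<^sup>2)"
  by (simp add: group_norm_def L2_set_def sum_nonneg)

lemma group_norm_scaleR: "c \<ge> 0 \<Longrightarrow> group_norm A (c *\<^sub>R v) = c * group_norm A v"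
  by (simp add: group_norm_def L2_set_right_distrib)

lemma scaled_K2_eq:
  assumes "\<tau> > 0"
  shows "(\<lambda>v. \<tau> *\<^sub>R v) ` K2 B G = {v. \<forall>r\<in>{1..B}. group_norm (G r) v \<le> \<tau>}"
proof (intro equalityI subsetI)
  fix v assume "v \<in> (\<lambda>v. \<tau> *\<^sub>R v) ` K2 B G"
  then show "v \<in> {v. \<forall>r\<in>{1..B}. group_norm (G r) v \<le> \<tau>}"
    using assms by (auto simp: K2_def group_norm_scaleR)
next
  fix v assume v: "v \<in> {v. \<forall>r\<in>{1..B}. group_norm (G r) v \<le> \<tau>}"
  have "(1 / \<tau>) *\<^sub>R v \<in> K2 B G"
    using v assms by (auto simp: K2_def group_norm_scaleR[of "1 / \<tau>"])
  moreover have "v = \<tau> *\<^sub>R ((1 / \<tau>) *\<^sub>R v)" using assms by simp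
  ultimately show "v \<in> (\<lambda>v. \<tau> *\<^sub>R v) ` K2 B G" by (rule rev_image_eqI)
qed

section \<open>The dual objective and its partial derivatives\<close>

definition multiplier_load :: "nat \<Rightarrow> (nat \<Rightarrow> 'd set) \<Rightarrow> (nat \<Rightarrow> real) \<Rightarrow> 'd \<Rightarrow> real" where
  "multiplier_load n H l j = (\<Sum>r\<in>{1..n}. indicat_real (H r) j * l r)"

definition shrink :: "nat \<Rightarrow> (nat \<Rightarrow> 'd set) \<Rightarrow> real ^ 'd \<Rightarrow> (nat \<Rightarrow> real) \<Rightarrow> real ^ 'd" where
  "shrink n H x l = (\<chi> j. x $ j / (1 + multiplier_load n H l j))"

lemma dual_objective_load:
  "dual_objective n H \<tau> x l =
     (\<Sum>j\<in>UNIV. - (x $ j)\<^sup>2 / (1 + multiplier_load n H l j)) - (\<Sum>r\<in>{1..n}. l r * \<tau>\<^sup>2)"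
  by (simp add: dual_objective_def multiplier_load_def)

lemma nonneg_orthantD: "l \<in> nonneg_orthant n \<Longrightarrow> r \<in> {1..n} \<Longrightarrow> 0 \<le> l r"
  by (auto simp: nonneg_orthant_def PiE_iff)

lemma multiplier_load_nonneg: "l \<in> nonneg_orthant n \<Longrightarrow> 0 \<le> multiplier_load n H l j"
  unfolding multiplier_load_def
  by (intro sum_nonneg mult_nonneg_nonneg) (auto intro: nonneg_orthantD)

lemma shrink_load_eq:
  assumes "l \<in> nonneg_orthant n"
  shows "x $ j - shrink n H x l $ j = multiplier_load n H l j * shrink n H x l $ j"
  using multiplier_load_nonneg[OF assms, of H j] by (simp add: shrink_def field_simps)

lemma group_norm_shrink_le:
  assumes "l \<in> nonneg_orthant n"
  shows "group_norm A (shrink n H x l) \<le> group_norm A x"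
proof -
  have "(shrink n H x l $ j)\<^sup>2 \<le> (x $ j)\<^sup>2" for j
  proof -
    have "\<bar>x $ j\<bar> / (1 + multiplier_load n H l j) \<le> \<bar>x $ j\<bar> / 1"
      using multiplier_load_nonneg[OF assms, of H j] by (intro divide_left_mono) auto
    then show ?thesis
      using multiplier_load_nonneg[OF assms, of H j]
      by (simp add: shrink_def abs_le_square_iff[symmetric] abs_divide)
  qed
  then have "(group_norm A (shrink n H x l))\<^sup>2 \<le> (group_norm A x)\<^sup>2"
    unfolding group_norm_sq by (intro sum_mono)
  then show ?thesis by (rule power2_le_imp_le) (rule group_norm_nonneg)
qed

lemma sum_fun_upd_affine:
  fixes c l :: "'i \<Rightarrow> real"
  assumes "finite R" "r \<in> R"
  shows "(\<Sum>i\<in>R. c i * (l(r := t)) i) = (\<Sum>i\<in>R. c i * l i) + c r * (t - l r)"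
proof -
  have "(\<Sum>i\<in>R - {r}. c i * (l(r := t)) i) = (\<Sum>i\<in>R - {r}. c i * l i)"
    by (rule sum.cong) auto
  then show ?thesis
    using assms by (simp add: sum.remove[of R r] algebra_simps)
qed

text \<open>The derivative of \<open>- a\<^sup>2 / (1 + s)\<close> in \<open>s\<close> is \<open>(a / (1 + s))\<^sup>2\<close>, the square of a
  coordinate of the shrunken vector.  Since \<open>s\<close> is affine in each multiplier, with slope the
  indicator of the group, the partial derivatives of the dual are the constraint residuals of
  \<open>shrink n H x l\<close>.\<close>

lemma dual_objective_partial_deriv:
  assumes l: "l \<in> nonneg_orthant n" and r: "r \<in> {1..n}"
  shows "((\<lambda>t. dual_objective n H \<tau> x (l(r := t))) has_real_derivative
           (group_norm (H r) (shrink n H x l))\<^sup>2 - \<tau>\<^sup>2) (at (l r))"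
proof -
  define s where "s = multiplier_load n H l"
  define e where "e j = indicat_real (H r) j" for j
  have pos: "1 + s j > 0" for j
    using multiplier_load_nonneg[OF l, of H j] by (simp add: s_def)
  have load: "multiplier_load n H (l(r := t)) j = s j + e j * (t - l r)" for t j
    unfolding multiplier_load_def s_def e_def
    using r by (intro sum_fun_upd_affine) auto
  have penalty: "(\<Sum>i\<in>{1..n}. (l(r := t)) i * \<tau>\<^sup>2) = (\<Sum>i\<in>{1..n}. l i * \<tau>\<^sup>2) + \<tau>\<^sup>2 * (t - l r)" for t
    using sum_fun_upd_affine[of "{1..n}" r "\<lambda>_. \<tau>\<^sup>2" l t] r
    by (simp add: mult.commute[of _ "\<tau>\<^sup>2"] del: fun_upd_apply)
  have expand: "(\<lambda>t. dual_objective n H \<tau> x (l(r := t))) =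
      (\<lambda>t. (\<Sum>j\<in>UNIV. - (x $ j)\<^sup>2 / (1 + (s j + e j * (t - l r))))
         - ((\<Sum>i\<in>{1..n}. l i * \<tau>\<^sup>2) + \<tau>\<^sup>2 * (t - l r)))"
    by (simp only: dual_objective_load load penalty)
  have term_deriv: "((\<lambda>t. - (x $ j)\<^sup>2 / (1 + (s j + e j * (t - l r)))) has_real_derivative
      e j * (shrink n H x l $ j)\<^sup>2) (at (l r))" for j
    using pos[of j]
    by (auto intro!: derivative_eq_intros
        simp: shrink_def s_def[symmetric] power2_eq_square field_simps)
  have norm_eq: "(group_norm (H r) (shrink n H x l))\<^sup>2 = (\<Sum>j\<in>UNIV. e j * (shrink n H x l $ j)\<^sup>2)"
    unfolding group_norm_sq e_def by simp
  show ?thesis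
    unfolding expand norm_eq
    by (intro DERIV_diff DERIV_sum term_deriv) (auto intro!: derivative_eq_intros)
qed

section \<open>Optimality conditions\<close>

text \<open>A maximiser over the orthant may have \<open>l r = 0\<close>, where only upward moves of the
  coordinate are feasible.  A positive derivative is contradicted by an upward move, a negative
  one by a downward move; hence the asymmetry of the two conclusions.\<close>

lemma dual_maximizer_KKT:
  assumes max: "is_arg_max (dual_objective n H \<tau> x) (\<lambda>l. l \<in> nonneg_orthant n) l"
    and r: "r \<in> {1..n}" and "\<tau> > 0"
  shows "group_norm (H r) (shrink n H x l) \<le> \<tau>"
    and "l r > 0 \<Longrightarrow> group_norm (H r) (shrink n H x l) = \<tau>"
proof -
  let ?f = "\<lambda>t. dual_objective n H \<tau> x (l(r := t))"
  let ?N = "group_norm (H r) (shrink n H x l)"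
  have l: "l \<in> nonneg_orthant n" using max by (simp add: is_arg_max_def)
  note D = dual_objective_partial_deriv[OF l r, of H \<tau> x]
  have no_gain: "?f t \<le> ?f (l r)" if "t \<ge> 0" for t
  proof -
    have "l(r := t) \<in> nonneg_orthant n"
      using l r that by (auto simp: nonneg_orthant_def PiE_iff extensional_def)
    then show ?thesis using max by (auto simp: is_arg_max_linorder)
  qed
  have upper: "\<not> 0 < ?N\<^sup>2 - \<tau>\<^sup>2"
  proof
    assume "0 < ?N\<^sup>2 - \<tau>\<^sup>2"
    from DERIV_pos_inc_right[OF D this] obtain d where
      "d > 0" and d: "\<And>h. h > 0 \<Longrightarrow> h < d \<Longrightarrow> ?f (l r) < ?f (l r + h)" by blast
    with no_gain[of "l r + d / 2"] d[of "d / 2"] nonneg_orthantD[OF l r] show False by auto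
  qed
  then have "?N\<^sup>2 \<le> \<tau>\<^sup>2" by simp
  then show le: "?N \<le> \<tau>"
    using \<open>\<tau> > 0\<close> by (rule power2_le_imp_le[OF _ less_imp_le])
  show "?N = \<tau>" if "l r > 0"
  proof -
    have "\<not> ?N\<^sup>2 - \<tau>\<^sup>2 < 0"
    proof
      assume "?N\<^sup>2 - \<tau>\<^sup>2 < 0"
      from DERIV_neg_dec_left[OF D this] obtain d where
        "d > 0" and d: "\<And>h. h > 0 \<Longrightarrow> h < d \<Longrightarrow> ?f (l r) < ?f (l r - h)" by blast
      define h where "h = min (d / 2) (l r)"
      have "h > 0" "h < d" "l r - h \<ge> 0" using \<open>d > 0\<close> that by (auto simp: h_def)
      with no_gain[of "l r - h"] d[of h] show False by auto
    qed
    then have "\<tau>\<^sup>2 \<le> ?N\<^sup>2" by simp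
    then have "\<tau> \<le> ?N"
      by (rule power2_le_imp_le[OF _ group_norm_nonneg])
    with le show ?thesis by simp
  qed
qed

text \<open>The residual \<open>x - v\<close> is \<open>v\<close> weighted by the loads, that is, a combination with
  coefficients \<open>l r\<close> of the restrictions of \<open>v\<close> to the groups.  Pairing it with \<open>y - v\<close>
  group by group puts every summand into a form that complementary slackness controls.\<close>

lemma inner_residual_eq_sum_groups:
  fixes x y :: "real ^ 'd" and H :: "nat \<Rightarrow> 'd set"
  assumes "l \<in> nonneg_orthant n"
  defines "v \<equiv> shrink n H x l"
  shows "(x - v) \<bullet> (y - v) = (\<Sum>r\<in>{1..n}. l r * ((\<Sum>j\<in>H r. v $ j * y $ j) - (group_norm (H r) v)\<^sup>2))"
proof -
  have "(x - v) \<bullet> (y - v) = (\<Sum>j\<in>UNIV. multiplier_load n H l j * (v $ j * (y $ j - v $ j)))"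
    using shrink_load_eq[OF assms(1), of x _ H]
    by (simp add: inner_vec_def v_def mult.assoc)
  also have "\<dots> = (\<Sum>j\<in>UNIV. \<Sum>r\<in>{1..n}. l r * (indicat_real (H r) j * (v $ j * (y $ j - v $ j))))"
    unfolding multiplier_load_def sum_distrib_right by (simp add: ac_simps)
  also have "\<dots> = (\<Sum>r\<in>{1..n}. l r * (\<Sum>j\<in>UNIV. indicat_real (H r) j * (v $ j * (y $ j - v $ j))))"
    by (subst sum.swap) (simp only: sum_distrib_left)
  also have "\<dots> = (\<Sum>r\<in>{1..n}. l r * (\<Sum>j\<in>H r. v $ j * (y $ j - v $ j)))"
    by simp
  also have "\<dots> = (\<Sum>r\<in>{1..n}. l r * ((\<Sum>j\<in>H r. v $ j * y $ j) - (group_norm (H r) v)\<^sup>2))"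
    unfolding group_norm_sq by (simp add: right_diff_distrib sum_subtractf power2_eq_square)
  finally show ?thesis .
qed

lemma closest_point_eq_shrink:
  fixes x :: "real ^ 'd"
  assumes "\<tau> > 0" and groups: "Gh ` {1..Bh} = active_groups B G \<tau> x"
    and max: "is_arg_max (dual_objective Bh Gh \<tau> x) (\<lambda>l. l \<in> nonneg_orthant Bh) l"
  shows "closest_point ((\<lambda>v. \<tau> *\<^sub>R v) ` K2 B G) x = shrink Bh Gh x l"
proof (rule closest_point_eqI_obtuse)
  let ?v = "shrink Bh Gh x l"
  have l: "l \<in> nonneg_orthant Bh" using max by (simp add: is_arg_max_def)
  note KKT = dual_maximizer_KKT[OF max _ \<open>\<tau> > 0\<close>]
  have "group_norm (G r) ?v \<le> \<tau>" if r: "r \<in> {1..B}" for r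
  proof (cases "group_norm (G r) x > \<tau>")
    case True
    with r have "G r \<in> Gh ` {1..Bh}" unfolding groups active_groups_def by blast
    with KKT(1) show ?thesis by auto
  next
    case False
    with group_norm_shrink_le[OF l, of "G r" Gh x] show ?thesis by linarith
  qed
  then show "?v \<in> (\<lambda>v. \<tau> *\<^sub>R v) ` K2 B G"
    by (simp add: scaled_K2_eq[OF \<open>\<tau> > 0\<close>])
  fix y assume "y \<in> (\<lambda>v. \<tau> *\<^sub>R v) ` K2 B G"
  then have y: "\<And>r. r \<in> {1..B} \<Longrightarrow> group_norm (G r) y \<le> \<tau>"
    by (simp add: scaled_K2_eq[OF \<open>\<tau> > 0\<close>])
  have "l r * ((\<Sum>j\<in>Gh r. ?v $ j * y $ j) - (group_norm (Gh r) ?v)\<^sup>2) \<le> 0" if r: "r \<in> {1..Bh}" for r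
  proof (cases "l r > 0")
    case True
    have "Gh r \<in> G ` {1..B}"
      using groups r unfolding active_groups_def by blast
    with y have yr: "group_norm (Gh r) y \<le> \<tau>" by auto
    have "(\<Sum>j\<in>Gh r. ?v $ j * y $ j) \<le> (\<Sum>j\<in>Gh r. \<bar>?v $ j\<bar> * \<bar>y $ j\<bar>)"
      by (intro sum_mono) (metis abs_ge_self abs_mult)
    also have "\<dots> \<le> group_norm (Gh r) ?v * group_norm (Gh r) y"
      unfolding group_norm_def by (rule L2_set_mult_ineq)
    also have "\<dots> \<le> \<tau> * \<tau>"
      using KKT(2)[OF r True] yr \<open>\<tau> > 0\<close> by simp
    finally show ?thesis
      using KKT(2)[OF r True] True
      by (simp add: mult_le_0_iff power2_eq_square)
  next
    case False
    with nonneg_orthantD[OF l r] show ?thesis by simp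
  qed
  then show "(x - ?v) \<bullet> (y - ?v) \<le> 0"
    unfolding inner_residual_eq_sum_groups[OF l] by (rule sum_nonpos)
qed

section \<open>Existence of a maximiser\<close>

text \<open>The box carries the topology of the full product over all indices, in which the
  coordinates outside \<open>{1..n}\<close> range over the singleton \<open>{undefined}\<close>; so it is an instance of
  Tychonoff's theorem.\<close>

lemma compact_PiE_box: "compact (PiE I (\<lambda>_. {a..b::real}))"
proof -
  have "PiE I (\<lambda>_. {a..b}) = PiE UNIV (\<lambda>i. if i \<in> I then {a..b} else {undefined})"
    by (auto simp: PiE_iff extensional_def split: if_splits)
  moreover have "compactin (product_topology (\<lambda>_. euclidean) UNIV) \<dots>"
    unfolding compactin_PiE by auto
  ultimately show ?thesis
    by (simp add: euclidean_product_topology)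
qed

lemma continuous_on_dual_objective: "continuous_on (nonneg_orthant n) (dual_objective n H \<tau> x)"
proof -
  have coord: "continuous_on (nonneg_orthant n) (\<lambda>l. l r)" for r
    by (rule continuous_on_product_coordinates[THEN continuous_on_subset]) simp
  have "1 + multiplier_load n H l j \<noteq> 0" if "l \<in> nonneg_orthant n" for l j
    using multiplier_load_nonneg[OF that, of H j] by linarith
  then show ?thesis
    unfolding dual_objective_def multiplier_load_def
    by (intro continuous_intros coord) auto
qed

lemma dual_objective_le:
  assumes l: "l \<in> nonneg_orthant n" and r: "r \<in> {1..n}"
  shows "dual_objective n H \<tau> x l \<le> - (l r * \<tau>\<^sup>2)"
proof -
  have "(\<Sum>j\<in>UNIV. - (x $ j)\<^sup>2 / (1 + multiplier_load n H l j)) \<le> 0"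
    using multiplier_load_nonneg[OF l, of H]
    by (intro sum_nonpos) (simp add: divide_nonneg_nonneg add_nonneg_nonneg)
  moreover have "l r * \<tau>\<^sup>2 \<le> (\<Sum>r\<in>{1..n}. l r * \<tau>\<^sup>2)"
    using r nonneg_orthantD[OF l] by (intro member_le_sum) auto
  ultimately show ?thesis unfolding dual_objective_load by linarith
qed

lemma dual_maximizer_exists:
  assumes "\<tau> > 0"
  shows "\<exists>l. is_arg_max (dual_objective n H \<tau> x) (\<lambda>l. l \<in> nonneg_orthant n) l"
proof -
  let ?f = "dual_objective n H \<tau> x"
  define z where "z = (\<lambda>r\<in>{1..n}. 0 :: real)"
  \<comment> \<open>Large enough that a point with a coordinate above \<open>M\<close> has value less than that of \<open>z\<close>.\<close>
  define M where "M = \<bar>?f z\<bar> / \<tau>\<^sup>2"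
  define K where "K = PiE {1..n} (\<lambda>_. {0..M})"
  have z: "z \<in> K" by (auto simp: z_def K_def M_def)
  have K_sub: "K \<subseteq> nonneg_orthant n"
    unfolding K_def nonneg_orthant_def by (intro PiE_mono) auto
  have "compact K" unfolding K_def by (rule compact_PiE_box)
  then obtain l where l: "l \<in> K" and l_max: "\<And>m. m \<in> K \<Longrightarrow> ?f m \<le> ?f l"
    using continuous_attains_sup[of K ?f] z
      continuous_on_subset[OF continuous_on_dual_objective K_sub] by blast
  have "?f m \<le> ?f l" if m: "m \<in> nonneg_orthant n" for m
  proof (cases "m \<in> K")
    case True
    then show ?thesis by (rule l_max)
  next
    case False
    then obtain r where r: "r \<in> {1..n}" and "M < m r"
      using m by (auto simp: K_def nonneg_orthant_def PiE_iff)
    then have "\<bar>?f z\<bar> < m r * \<tau>\<^sup>2"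
      using assms by (simp add: M_def pos_divide_less_eq)
    with dual_objective_le[OF m r, of H \<tau> x] have "?f m \<le> ?f z" by linarith
    with l_max[OF z] show ?thesis by linarith
  qed
  with l K_sub show ?thesis by (auto simp: is_arg_max_linorder)
qed

section \<open>The projection formula\<close>

theorem theorem1:
  fixes x :: "real ^ 'd"
    and B Bh :: nat
    and G Gh :: "nat \<Rightarrow> 'd set"
    and \<tau> :: real
  assumes "(\<Union>r\<in>{1..B}. G r) = UNIV"
    and "\<tau> > 0"
    and "Gh ` {1..Bh} = active_groups B G \<tau> x"
  shows "(\<exists>l. is_arg_max (dual_objective Bh Gh \<tau> x) (\<lambda>l. l \<in> nonneg_orthant Bh) l) \<and>
    (\<forall>l. is_arg_max (dual_objective Bh Gh \<tau> x) (\<lambda>l. l \<in> nonneg_orthant Bh) l \<longrightarrow>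
      (\<forall>j. closest_point ((\<lambda>v. \<tau> *\<^sub>R v) ` K2 B G) x $ j =
         x $ j / (1 + (\<Sum>r\<in>{1..Bh}. l r * indicat_real (Gh r) j))))"
  using dual_maximizer_exists[OF assms(2)] closest_point_eq_shrink[OF assms(2,3)]
  by (simp add: shrink_def multiplier_load_def mult.commute)

end
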